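(* Let $\alpha\in\{0,1,\omega,\Omega\}$ and let $\mathbb{T}=(T,y,m)$ be the $\alpha$-filter monad on the category $\mathsf{Top}$ of topological spaces. A topological space $X$ is $\mathbb{T}$-distributive if and only if $X$ is sober, $\mathbb{T}$-core-compact, $\mathbb{T}$-stable and $\mathbb{T}$-disconnected.
   Context: For a topological space $X$, $\mathcal{O}X$ is the lattice of open subsets and $\mathcal{O}(x)$ the set of open neighbourhoods of $x\in X$. A space carries the (pre)order $x\le x' :\iff \mathcal{O}(x')\subseteq\mathcal{O}(x)$ (dual of the specialisation order), and continuous maps are ordered pointwise. Continuous maps $f:X\to Y$, $g:Y\to X$ form an adjunction $f\dashv g$ ($f$ left adjoint, $g$ right adjoint, in $\mathsf{Top}$) if $1_X\le g f$ and $f g\le 1_Y$. A filter on $\mathcal{O}X$ is an up-closed subset of $\mathcal{O}X$ containing $X$ and closed under binary intersection (the improper filter is allowed). A filter $\mathfrak{f}$ converges to $x$, written $\mathfrak{f}\to x$, if $\mathcal{O}(x)\subseteq\mathfrak{f}$; then $x$ is a limit point of $\mathfrak{f}$. Smallest limit points are smallest with respect to $\le$. For $\alpha\in\{0,1,\omega,\Omega\}$, where $\Omega$ denotes the class of all cardinals (so $\#(I)<\Omega$ for every set $I$), $\mathfrak{f}$ is an $\alpha$-filter if for every family $(A_i)_{i\in I}$ of open sets with $\#(I)<\alpha$, $\bigcup_{i\in I}A_i\in\mathfrak{f}$ implies $A_i\in\mathfrak{f}$ for some $i\in I$. (So for $\alpha=0,1,\omega,\Omega$ one gets all, proper, prime,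 completely prime filters, respectively.) The $\alpha$-filter monad $\mathbb{T}=(T,y,m)$ on $\mathsf{Top}$: $TX$ is the set of all $\alpha$-filters on $\mathcal{O}X$ with the topology generated by the sets $A^\#=\{\mathfrak{f}\in TX\mid A\in\mathfrak{f}\}$, $A\in\mathcal{O}X$ (so $\mathfrak{f}\le\mathfrak{g}\iff\mathfrak{f}\supseteq\mathfrak{g}$); $Tf(\mathfrak{f})=\{B\text{ open}\mid f^{-1}(B)\in\mathfrak{f}\}$; $y_X(x)=\mathcal{O}(x)$; $m_X(\mathfrak{F})=\{A\in\mathcal{O}X\mid A^\#\in\mathfrak{F}\}$ for $\mathfrak{F}\in TTX$. A space $X$ admits at most one (Eilenberg-Moore) $\mathbb{T}$-algebra structure $l:TX\to X$; one says $X$ is a $\mathbb{T}$-algebra if it admits one. In this case $l\dashv y_X$ and $l(\mathfrak{f})$ is the smallest limit point of $\mathfrak{f}$. A space $X$ is $\mathbb{T}$-distributive if it is a $\mathbb{T}$-algebra and its structure map $l:TX\to X$ has a left adjoint $t:X\to TX$ in $\mathsf{Top}$. For $U,V\in\mathcal{O}X$, $U\ll_{\mathbb{T}}V$ means that every $\mathfrak{f}\in TX$ with $U\in\mathfrak{f}$ has a limit point in $V$. $X$ is $\mathbb{T}$-core-compact if for every $x\in X$ and $U\in\mathcal{O}(x)$ there is $V\in\mathcal{O}(x)$ with $V\ll_{\mathbb{T}}U$. $X$ is $\mathbb{T}$-stable if for all $n\in\mathbb{N}$ (including $n=0$, where the empty intersection is $X$) and open sets $V_i\ll_{\mathbb{T}}U_i$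 ($1\le i\le n$) one has $\bigcap_{i=1}^nV_i\ll_{\mathbb{T}}\bigcap_{i=1}^nU_i$. For a $\mathbb{T}$-algebra $X$ with structure map $l$ and $A\in\mathcal{O}X$, put $\mu(A)=\{x\in X\mid x=l(\mathfrak{f})\text{ for some }\mathfrak{f}\in TX\text{ with }A\in\mathfrak{f}\}$. A $\mathbb{T}$-algebra $X$ is $\mathbb{T}$-disconnected if $\mu(A)$ is open for every $A\in\mathcal{O}X$. (Every sober, $\mathbb{T}$-core-compact and $\mathbb{T}$-stable space is a $\mathbb{T}$-algebra.) Sober means that every irreducible closed set is the closure of a unique point (in particular T$_0$). *)

theory Defs
  imports "HOL-Analysis.Analysis"
begin

definition open_nhds :: "'a topology \<Rightarrow> 'a \<Rightarrow> 'a set set" where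
  "open_nhds X x = {A. openin X A \<and> x \<in> A}"

text \<open>The order used here is the dual of the specialisation order.\<close>

definition pt_le :: "'a topology \<Rightarrow> 'a \<Rightarrow> 'a \<Rightarrow> bool" where
  "pt_le X x x' \<longleftrightarrow> open_nhds X x' \<subseteq> open_nhds X x"

definition top_adjunction ::
    "'a topology \<Rightarrow> 'b topology \<Rightarrow> ('a \<Rightarrow> 'b) \<Rightarrow> ('b \<Rightarrow> 'a) \<Rightarrow> bool" where
  "top_adjunction X Y f g \<longleftrightarrow>
     continuous_map X Y f \<and> continuous_map Y X g \<and>
     (\<forall>x\<in>topspace X. pt_le X x (g (f x))) \<and>
     (\<forall>y\<in>topspace Y. pt_le Y (f (g y)) y)"

text \<open>The four values of the parameter; \<open>Card_Omega\<close> stands for the class of all cardinals.\<close>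

datatype filter_card = Card_0 | Card_1 | Card_omega | Card_Omega

fun card_less :: "'i set \<Rightarrow> filter_card \<Rightarrow> bool" where
  "card_less I Card_0 \<longleftrightarrow> False"
| "card_less I Card_1 \<longleftrightarrow> I = {}"
| "card_less I Card_omega \<longleftrightarrow> finite I"
| "card_less I Card_Omega \<longleftrightarrow> True"

definition open_filter :: "'a topology \<Rightarrow> 'a set set \<Rightarrow> bool" where
  "open_filter X \<ff> \<longleftrightarrow>
     (\<forall>A\<in>\<ff>. openin X A) \<and> topspace X \<in> \<ff> \<and>
     (\<forall>A\<in>\<ff>. \<forall>B. openin X B \<and> A \<subseteq> B \<longrightarrow> B \<in> \<ff>) \<and>
     (\<forall>A\<in>\<ff>. \<forall>B\<in>\<ff>. A \<inter> B \<in> \<ff>)"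

text \<open>A family of open sets is given by the set \<open>\<A>\<close> of its members: for the four bounds
  considered, the range of a family indexed below the bound is again below the bound.\<close>

definition alpha_filter :: "filter_card \<Rightarrow> 'a topology \<Rightarrow> 'a set set \<Rightarrow> bool" where
  "alpha_filter \<alpha> X \<ff> \<longleftrightarrow>
     open_filter X \<ff> \<and>
     (\<forall>\<A>. (\<forall>A\<in>\<A>. openin X A) \<and> card_less \<A> \<alpha> \<and> \<Union>\<A> \<in> \<ff> \<longrightarrow> (\<exists>A\<in>\<A>. A \<in> \<ff>))"

definition sharp :: "filter_card \<Rightarrow> 'a topology \<Rightarrow> 'a set \<Rightarrow> 'a set set set" where
  "sharp \<alpha> X A = {\<ff>. alpha_filter \<alpha> X \<ff> \<and> A \<in> \<ff>}"

definition T_space :: "filter_card \<Rightarrow> 'a topology \<Rightarrow> 'a set set topology" where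
  "T_space \<alpha> X = topology_generated_by {sharp \<alpha> X A | A. openin X A}"

definition T_map :: "'a topology \<Rightarrow> 'b topology \<Rightarrow> ('a \<Rightarrow> 'b) \<Rightarrow> 'a set set \<Rightarrow> 'b set set" where
  "T_map X Y f \<ff> = {B. openin Y B \<and> {x \<in> topspace X. f x \<in> B} \<in> \<ff>}"

definition T_unit :: "'a topology \<Rightarrow> 'a \<Rightarrow> 'a set set" where
  "T_unit X x = open_nhds X x"

definition T_mult :: "filter_card \<Rightarrow> 'a topology \<Rightarrow> 'a set set set set \<Rightarrow> 'a set set" where
  "T_mult \<alpha> X \<FF> = {A. openin X A \<and> sharp \<alpha> X A \<in> \<FF>}"

text \<open>Eilenberg-Moore algebra structures. Maps are equal when they agree on the underlying set of
  their domain.\<close>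

definition T_structure :: "filter_card \<Rightarrow> 'a topology \<Rightarrow> ('a set set \<Rightarrow> 'a) \<Rightarrow> bool" where
  "T_structure \<alpha> X l \<longleftrightarrow>
     continuous_map (T_space \<alpha> X) X l \<and>
     (\<forall>x\<in>topspace X. l (T_unit X x) = x) \<and>
     (\<forall>\<FF>\<in>topspace (T_space \<alpha> (T_space \<alpha> X)).
        l (T_map (T_space \<alpha> X) X l \<FF>) = l (T_mult \<alpha> X \<FF>))"

definition T_algebra :: "filter_card \<Rightarrow> 'a topology \<Rightarrow> bool" where
  "T_algebra \<alpha> X \<longleftrightarrow> (\<exists>l. T_structure \<alpha> X l)"

definition T_distributive :: "filter_card \<Rightarrow> 'a topology \<Rightarrow> bool" where
  "T_distributive \<alpha> X \<longleftrightarrow>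
     (\<exists>l. T_structure \<alpha> X l \<and> (\<exists>t. top_adjunction X (T_space \<alpha> X) t l))"

definition converges_to :: "'a topology \<Rightarrow> 'a set set \<Rightarrow> 'a \<Rightarrow> bool" where
  "converges_to X \<ff> x \<longleftrightarrow> x \<in> topspace X \<and> open_nhds X x \<subseteq> \<ff>"

definition way_below :: "filter_card \<Rightarrow> 'a topology \<Rightarrow> 'a set \<Rightarrow> 'a set \<Rightarrow> bool" where
  "way_below \<alpha> X U V \<longleftrightarrow>
     openin X U \<and> openin X V \<and>
     (\<forall>\<ff>\<in>topspace (T_space \<alpha> X). U \<in> \<ff> \<longrightarrow> (\<exists>x\<in>V. converges_to X \<ff> x))"

definition T_core_compact :: "filter_card \<Rightarrow> 'a topology \<Rightarrow> bool" where
  "T_core_compact \<alpha> X \<longleftrightarrow>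
     (\<forall>x\<in>topspace X. \<forall>U\<in>open_nhds X x. \<exists>V\<in>open_nhds X x. way_below \<alpha> X V U)"

text \<open>Intersecting with \<open>topspace X\<close> makes the empty intersection the whole space.\<close>

definition T_stable :: "filter_card \<Rightarrow> 'a topology \<Rightarrow> bool" where
  "T_stable \<alpha> X \<longleftrightarrow>
     (\<forall>n::nat. \<forall>V U. (\<forall>i\<in>{1..n}. way_below \<alpha> X (V i) (U i)) \<longrightarrow>
        way_below \<alpha> X (topspace X \<inter> (\<Inter>i\<in>{1..n}. V i)) (topspace X \<inter> (\<Inter>i\<in>{1..n}. U i)))"

definition mu_set :: "filter_card \<Rightarrow> 'a topology \<Rightarrow> ('a set set \<Rightarrow> 'a) \<Rightarrow> 'a set \<Rightarrow> 'a set" where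
  "mu_set \<alpha> X l A = {x \<in> topspace X. \<exists>\<ff>\<in>topspace (T_space \<alpha> X). A \<in> \<ff> \<and> x = l \<ff>}"

definition T_disconnected :: "filter_card \<Rightarrow> 'a topology \<Rightarrow> bool" where
  "T_disconnected \<alpha> X \<longleftrightarrow>
     (\<exists>l. T_structure \<alpha> X l \<and> (\<forall>A. openin X A \<longrightarrow> openin X (mu_set \<alpha> X l A)))"

definition irreducible_closedin :: "'a topology \<Rightarrow> 'a set \<Rightarrow> bool" where
  "irreducible_closedin X C \<longleftrightarrow>
     closedin X C \<and> C \<noteq> {} \<and>
     (\<forall>D E. closedin X D \<and> closedin X E \<and> C = D \<union> E \<longrightarrow> C = D \<or> C = E)"

definition sober_space :: "'a topology \<Rightarrow> bool" where
  "sober_space X \<longleftrightarrow>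
     (\<forall>C. irreducible_closedin X C \<longrightarrow> (\<exists>!x. x \<in> topspace X \<and> C = X closure_of {x}))"

text \<open>The existentially quantified structure map in the definitions above is unique, being the
  smallest limit point.\<close>

lemma alpha_filterD:
  assumes "alpha_filter \<alpha> X \<ff>"
  shows "\<And>A B. A \<in> \<ff> \<Longrightarrow> openin X B \<Longrightarrow> A \<subseteq> B \<Longrightarrow> B \<in> \<ff>"
    and "\<And>A B. A \<in> \<ff> \<Longrightarrow> B \<in> \<ff> \<Longrightarrow> A \<inter> B \<in> \<ff>"
  using assms unfolding alpha_filter_def open_filter_def by blast+

lemma topspace_T_space: "topspace (T_space \<alpha> X) = {\<ff>. alpha_filter \<alpha> X \<ff>}"
proof (intro equalityI subsetI)
  fix \<ff> assume "\<ff> \<in> topspace (T_space \<alpha> X)"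
  then show "\<ff> \<in> {\<ff>. alpha_filter \<alpha> X \<ff>}"
    unfolding T_space_def topology_generated_by_topspace sharp_def by blast
next
  fix \<ff> assume "\<ff> \<in> {\<ff>. alpha_filter \<alpha> X \<ff>}"
  then have f: "alpha_filter \<alpha> X \<ff>" by (rule CollectD)
  then have "topspace X \<in> \<ff>"
    unfolding alpha_filter_def open_filter_def by (elim conjE)
  then have "\<ff> \<in> sharp \<alpha> X (topspace X)"
    unfolding sharp_def using f by (intro CollectI conjI)
  then show "\<ff> \<in> topspace (T_space \<alpha> X)"
    unfolding T_space_def topology_generated_by_topspace
    using openin_topspace[of X] by (intro UnionI[of "sharp \<alpha> X (topspace X)"] CollectI exI[of _ "topspace X"] conjI refl)
qed

lemma alpha_filter_open_nhds:
  assumes "x \<in> topspace X" shows "alpha_filter \<alpha> X (open_nhds X x)"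
proof -
  have "open_filter X (open_nhds X x)"
    using assms unfolding open_filter_def open_nhds_def by (auto simp: openin_Int)
  moreover have "\<exists>A\<in>\<A>. A \<in> open_nhds X x"
    if "\<forall>A\<in>\<A>. openin X A" "\<Union>\<A> \<in> open_nhds X x" for \<A>
    using that unfolding open_nhds_def by blast
  ultimately show ?thesis unfolding alpha_filter_def by blast
qed

lemma openin_T_space_basis:
  assumes "openin (T_space \<alpha> X) W" "\<ff> \<in> W"
  shows "\<exists>A. openin X A \<and> A \<in> \<ff> \<and> sharp \<alpha> X A \<subseteq> W"
proof -
  have "generate_topology_on {sharp \<alpha> X A | A. openin X A} W"
    using assms(1) unfolding T_space_def openin_topology_generated_by_iff .
  then show ?thesis using assms(2)
  proof (induction arbitrary: \<ff>)
    case Empty then show ?case by simp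
  next
    case (Int a b)
    obtain A where A: "openin X A" "A \<in> \<ff>" "sharp \<alpha> X A \<subseteq> a"
      using Int.IH(1)[of \<ff>] Int.prems by auto
    obtain B where B: "openin X B" "B \<in> \<ff>" "sharp \<alpha> X B \<subseteq> b"
      using Int.IH(2)[of \<ff>] Int.prems by auto
    have "openin (T_space \<alpha> X) a"
      using Int.hyps unfolding T_space_def openin_topology_generated_by_iff by simp
    then have f: "alpha_filter \<alpha> X \<ff>"
      using Int.prems openin_subset[of "T_space \<alpha> X" a] by (auto simp: topspace_T_space)
    have mono: "sharp \<alpha> X C \<subseteq> sharp \<alpha> X D" if "C \<subseteq> D" "openin X D" for C D
      using that by (auto simp: sharp_def intro: alpha_filterD(1))
    have "openin X (A \<inter> B)" using A(1) B(1) by (rule openin_Int)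
    moreover have "A \<inter> B \<in> \<ff>"
      by (rule alpha_filterD(2)[OF f A(2) B(2)])
    moreover have "sharp \<alpha> X (A \<inter> B) \<subseteq> a \<inter> b"
      using mono[OF Int_lower1[of A B] A(1)] mono[OF Int_lower2[of A B] B(1)] A(3) B(3) by auto
    ultimately show ?case by blast
  next
    case (UN K)
    then obtain k where k: "k \<in> K" "\<ff> \<in> k" by blast
    obtain A where "openin X A" "A \<in> \<ff>" "sharp \<alpha> X A \<subseteq> k"
      using UN.IH[OF k] by blast
    then show ?case using k(1) by (intro exI[of _ A]) auto
  next
    case (Basis s) then show ?case by (auto simp: sharp_def)
  qed
qed

lemma T_structure_smallest_limit:
  assumes l: "T_structure \<alpha> X l" and f: "alpha_filter \<alpha> X \<ff>"
  shows "converges_to X \<ff> (l \<ff>)"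
    and "converges_to X \<ff> x \<Longrightarrow> pt_le X (l \<ff>) x"
proof -
  have cont: "continuous_map (T_space \<alpha> X) X l"
    and unit: "\<And>x. x \<in> topspace X \<Longrightarrow> l (open_nhds X x) = x"
    using l by (auto simp: T_structure_def T_unit_def)
  have pre: "\<exists>B. openin X B \<and> B \<in> \<gg> \<and> (\<forall>\<hh>\<in>sharp \<alpha> X B. l \<hh> \<in> A)"
    if "alpha_filter \<alpha> X \<gg>" "openin X A" "l \<gg> \<in> A" for A \<gg>
  proof -
    have "\<gg> \<in> {\<hh> \<in> topspace (T_space \<alpha> X). l \<hh> \<in> A}"
      using that by (simp add: topspace_T_space)
    from openin_T_space_basis[OF openin_continuous_map_preimage[OF cont that(2)] this]
    show ?thesis by (simp add: subset_iff) blast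
  qed
  have "A \<in> \<ff>" if A: "openin X A" "l \<ff> \<in> A" for A
  proof -
    obtain B where B: "openin X B" "B \<in> \<ff>" "\<forall>\<hh>\<in>sharp \<alpha> X B. l \<hh> \<in> A"
      using pre[OF f A] by blast
    have "B \<subseteq> A"
    proof
      fix x assume x: "x \<in> B"
      then have xX: "x \<in> topspace X" using B(1) openin_subset by blast
      have "open_nhds X x \<in> sharp \<alpha> X B"
        using x B(1) alpha_filter_open_nhds[OF xX] by (simp add: sharp_def open_nhds_def)
      then show "x \<in> A" using B(3) unit[OF xX] by force
    qed
    then show ?thesis using alpha_filterD(1)[OF f B(2) A(1)] by simp
  qed
  moreover have "l \<ff> \<in> topspace X"
    using cont f by (auto simp: continuous_map_def topspace_T_space)
  ultimately show "converges_to X \<ff> (l \<ff>)"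
    by (auto simp: converges_to_def open_nhds_def)
  show "pt_le X (l \<ff>) x" if x: "converges_to X \<ff> x"
  proof -
    have xX: "x \<in> topspace X" using x by (simp add: converges_to_def)
    have "l \<ff> \<in> A" if A: "openin X A" "x \<in> A" for A
    proof -
      obtain B where B: "openin X B" "B \<in> open_nhds X x" "\<forall>\<hh>\<in>sharp \<alpha> X B. l \<hh> \<in> A"
        using pre[OF alpha_filter_open_nhds[OF xX] A(1)] A(2) unit[OF xX] by auto
      have "B \<in> \<ff>" using B(2) x by (auto simp: converges_to_def)
      then show ?thesis using B(3) f by (simp add: sharp_def)
    qed
    then show ?thesis by (auto simp: pt_le_def open_nhds_def)
  qed
qed

lemma T_structure_unique:
  assumes l: "T_structure \<alpha> X l" and l': "T_structure \<alpha> X l'"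
    and f: "\<ff> \<in> topspace (T_space \<alpha> X)"
  shows "l \<ff> = l' \<ff>"
proof -
  have f': "alpha_filter \<alpha> X \<ff>" using f by (simp add: topspace_T_space)
  note A = T_structure_smallest_limit[OF l f'] and B = T_structure_smallest_limit[OF l' f']
  have "open_nhds X (l \<ff>) = open_nhds X (l' \<ff>)"
    using A(2)[OF B(1)] B(2)[OF A(1)] by (auto simp: pt_le_def)
  moreover have "l (open_nhds X z) = z" if "z \<in> topspace X" for z
    using l that by (simp add: T_structure_def T_unit_def)
  moreover have "l \<ff> \<in> topspace X" "l' \<ff> \<in> topspace X"
    using A(1) B(1) by (auto simp: converges_to_def)
  ultimately show ?thesis by metis
qed

end

theory Submission imports Defs begin

text \<open>If \<open>t \<stileturn> l\<close>, then \<open>t x\<close> is the largest \<open>\<alpha>\<close>-filter sent to \<open>x\<close> by \<open>l\<close>, so the adjoint can only be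
  \<open>t x = {A. x \<in> \<mu>(A)}\<close>, and \<open>t\<close> is continuous iff every \<open>\<mu>(A)\<close> is open. Sobriety, core-compactness
  and stability hold in every \<open>\<T>\<close>-algebra. In the converse direction the only difficulty is that
  \<open>t x\<close> is closed under intersections: since \<open>A \<inter> \<mu>(B) \<subseteq> \<mu>(A \<inter> B)\<close>, this reduces to
  \<open>\<mu>(C) \<in> \<ff> \<Longrightarrow> l \<ff> \<in> \<mu>(C)\<close>. To see the latter, lift \<open>\<ff>\<close> along \<open>l\<close> to some \<open>\<FF> \<in> TTX\<close> containing
  \<open>C\<^sup>#\<close> (by the prime filter theorem if \<open>\<alpha> = \<omega>\<close>); then \<open>l \<ff> = l (m \<FF>)\<close> with \<open>C \<in> m \<FF>\<close>. For
  \<open>\<alpha> = \<Omega>\<close> no lifting is available, but there every \<open>\<ff>\<close> is the neighbourhood filter of \<open>l \<ff>\<close>.\<close>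

section \<open>Filters of open sets and the topology of TX\<close>

lemma alpha_filter_openin: "alpha_filter \<alpha> X \<ff> \<Longrightarrow> A \<in> \<ff> \<Longrightarrow> openin X A"
  unfolding alpha_filter_def open_filter_def by blast

lemma alpha_filter_topspace: "alpha_filter \<alpha> X \<ff> \<Longrightarrow> topspace X \<in> \<ff>"
  unfolding alpha_filter_def open_filter_def by blast

lemma alpha_filter_Union:
  assumes "alpha_filter \<alpha> X \<ff>" "\<And>A. A \<in> \<A> \<Longrightarrow> openin X A" "card_less \<A> \<alpha>" "\<Union>\<A> \<in> \<ff>"
  shows "\<exists>A\<in>\<A>. A \<in> \<ff>"
  using assms unfolding alpha_filter_def by blast

lemma open_filterD:
  assumes "open_filter X \<ff>"
  shows "\<And>A. A \<in> \<ff> \<Longrightarrow> openin X A"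
    and "topspace X \<in> \<ff>"
    and "\<And>A B. A \<in> \<ff> \<Longrightarrow> openin X B \<Longrightarrow> A \<subseteq> B \<Longrightarrow> B \<in> \<ff>"
    and "\<And>A B. A \<in> \<ff> \<Longrightarrow> B \<in> \<ff> \<Longrightarrow> A \<inter> B \<in> \<ff>"
  using assms unfolding open_filter_def by blast+

lemma open_filter_Int_iff:
  assumes "open_filter X \<ff>" "openin X A" "openin X B"
  shows "A \<inter> B \<in> \<ff> \<longleftrightarrow> A \<in> \<ff> \<and> B \<in> \<ff>"
  using open_filterD(3,4)[OF assms(1)] assms(2,3) by (meson Int_lower1 Int_lower2)

lemma card_less_image: "card_less I \<alpha> \<Longrightarrow> card_less (f ` I) \<alpha>"
  by (cases \<alpha>) auto

lemma openin_sharp: "openin X A \<Longrightarrow> openin (T_space \<alpha> X) (sharp \<alpha> X A)"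
  unfolding T_space_def by (rule topology_generated_by_Basis) auto

text \<open>Both directions are tested on the sets \<open>sharp \<alpha> X A\<close>, which form a
  basis: \<open>\<gg>\<close> lies in such a set exactly if \<open>A \<in> \<gg>\<close>. A larger
  filter is therefore a smaller point.\<close>

lemma pt_le_T_space:
  assumes f: "alpha_filter \<alpha> X \<ff>" and g: "alpha_filter \<alpha> X \<gg>"
  shows "pt_le (T_space \<alpha> X) \<ff> \<gg> \<longleftrightarrow> \<gg> \<subseteq> \<ff>"
proof
  assume le: "pt_le (T_space \<alpha> X) \<ff> \<gg>"
  show "\<gg> \<subseteq> \<ff>"
  proof
    fix A assume A: "A \<in> \<gg>"
    then have "sharp \<alpha> X A \<in> open_nhds (T_space \<alpha> X) \<gg>"
      using g openin_sharp[OF alpha_filter_openin[OF g A]] by (simp add: open_nhds_def sharp_def)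
    then show "A \<in> \<ff>"
      using le by (auto simp: pt_le_def open_nhds_def sharp_def)
  qed
next
  assume sub: "\<gg> \<subseteq> \<ff>"
  have "\<ff> \<in> W" if "openin (T_space \<alpha> X) W" "\<gg> \<in> W" for W
    using openin_T_space_basis[OF that] sub f by (auto simp: sharp_def)
  then show "pt_le (T_space \<alpha> X) \<ff> \<gg>"
    by (auto simp: pt_le_def open_nhds_def)
qed

lemma continuous_map_into_T_space:
  assumes t: "\<And>x. x \<in> topspace X \<Longrightarrow> alpha_filter \<alpha> Y (t x)"
    and op: "\<And>A. openin Y A \<Longrightarrow> openin X {x \<in> topspace X. A \<in> t x}"
  shows "continuous_map X (T_space \<alpha> Y) t"
  unfolding T_space_def
proof (rule continuous_on_generated_topo)
  fix W assume "W \<in> {sharp \<alpha> Y A |A. openin Y A}"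
  then obtain A where A: "openin Y A" "W = sharp \<alpha> Y A" by blast
  have "t -` W \<inter> topspace X = {x \<in> topspace X. A \<in> t x}"
    using t A by (auto simp: sharp_def)
  then show "openin X (t -` W \<inter> topspace X)" using op[OF A(1)] by simp
next
  have "t x \<in> sharp \<alpha> Y (topspace Y)" if "x \<in> topspace X" for x
    using t[OF that] by (simp add: sharp_def alpha_filter_topspace)
  then show "t ` topspace X \<subseteq> \<Union>{sharp \<alpha> Y A |A. openin Y A}" by blast
qed

section \<open>Enlarging filters to \<alpha>-filters\<close>

lemma open_filter_Union_chain:
  assumes "\<C> \<noteq> {}" "\<And>\<ff>. \<ff> \<in> \<C> \<Longrightarrow> open_filter X \<ff>"
    and "\<And>\<ff> \<gg>. \<ff> \<in> \<C> \<Longrightarrow> \<gg> \<in> \<C> \<Longrightarrow> \<ff> \<subseteq> \<gg> \<or> \<gg> \<subseteq> \<ff>"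
  shows "open_filter X (\<Union>\<C>)"
  unfolding open_filter_def
proof (intro conjI ballI allI impI)
  fix A B assume "A \<in> \<Union>\<C>" "B \<in> \<Union>\<C>"
  then obtain \<ff> \<gg> where "\<ff> \<in> \<C>" "A \<in> \<ff>" "\<gg> \<in> \<C>" "B \<in> \<gg>" by blast
  then obtain \<hh> where "\<hh> \<in> \<C>" "A \<in> \<hh>" "B \<in> \<hh>" using assms(3)[of \<ff> \<gg>] by blast
  then show "A \<inter> B \<in> \<Union>\<C>" using assms(2)[of \<hh>] unfolding open_filter_def by blast
next
  show "topspace X \<in> \<Union>\<C>" using assms(1,2) unfolding open_filter_def by blast
next
  fix A B assume "A \<in> \<Union>\<C>" and B: "openin X B \<and> A \<subseteq> B"
  then obtain \<ff> where "\<ff> \<in> \<C>" "A \<in> \<ff>" by blast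
  then show "B \<in> \<Union>\<C>" using assms(2)[of \<ff>] B unfolding open_filter_def by blast
next
  fix A assume "A \<in> \<Union>\<C>"
  then show "openin X A" using assms(2) unfolding open_filter_def by blast
qed

text \<open>This is the filter generated by \<open>\<ff>\<close> and \<open>A\<close>. It serves
  twice: to exploit maximality in the prime filter theorem, and to force a set
  \<open>sharp \<alpha> X C\<close> into a filter on TX.\<close>

lemma open_filter_adjoin:
  assumes F: "open_filter X \<ff>" and A: "openin X A"
  shows "open_filter X {B. openin X B \<and> (\<exists>G\<in>\<ff>. G \<inter> A \<subseteq> B)}" (is "open_filter X ?H")
proof -
  have "topspace X \<in> ?H"
    using open_filterD(2)[OF F] by blast
  moreover have "B \<inter> C \<in> ?H" if BC: "B \<in> ?H" "C \<in> ?H" for B C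
  proof -
    obtain G G' where G: "G \<in> \<ff>" "G \<inter> A \<subseteq> B" "G' \<in> \<ff>" "G' \<inter> A \<subseteq> C"
      using BC by blast
    have "G \<inter> G' \<in> \<ff>" by (rule open_filterD(4)[OF F G(1,3)])
    moreover have "(G \<inter> G') \<inter> A \<subseteq> B \<inter> C" using G by blast
    ultimately show ?thesis using BC by blast
  qed
  moreover have "C \<in> ?H" if BC: "B \<in> ?H" "openin X C \<and> B \<subseteq> C" for B C
  proof -
    obtain G where "G \<in> \<ff>" "G \<inter> A \<subseteq> B" using BC by blast
    then show ?thesis using BC(2) by (intro CollectI conjI bexI[of _ G]) auto
  qed
  moreover have "openin X B" if "B \<in> ?H" for B using that by (rule CollectE) simp
  ultimately show ?thesis unfolding open_filter_def by (intro conjI ballI allI impI)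
qed

lemma open_filter_Inter:
  assumes F: "open_filter X \<ff>" and "finite I" "\<And>i. i \<in> I \<Longrightarrow> G i \<in> \<ff>"
  shows "topspace X \<inter> (\<Inter>i\<in>I. G i) \<in> \<ff>"
  using assms(2,3)
proof (induction I rule: finite_induct)
  case empty
  show ?case using open_filterD(2)[OF F] by simp
next
  case (insert i I)
  then have "G i \<inter> (topspace X \<inter> (\<Inter>i\<in>I. G i)) \<in> \<ff>"
    by (intro open_filterD(4)[OF F, of "G i"]) simp_all
  then show ?case by (simp add: Int_ac)
qed

text \<open>The order dual of \<alpha>-filters, with the union condition scaled to \<alpha>: it is
  vacuous for \<open>Card_0\<close>, says that \<open>{}\<close> is a member for
  \<open>Card_1\<close>, and gives closure under finite unions for
  \<open>Card_omega\<close>.\<close>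

definition alpha_ideal :: "filter_card \<Rightarrow> 'a topology \<Rightarrow> 'a set set \<Rightarrow> bool" where
  "alpha_ideal \<alpha> X \<I> \<longleftrightarrow>
     (\<forall>A\<in>\<I>. \<forall>B. openin X B \<and> B \<subseteq> A \<longrightarrow> B \<in> \<I>) \<and>
     (\<forall>\<A>. \<A> \<subseteq> \<I> \<and> card_less \<A> \<alpha> \<longrightarrow> \<Union>\<A> \<in> \<I>)"

lemma alpha_idealD:
  assumes "alpha_ideal \<alpha> X \<I>"
  shows "\<And>A B. A \<in> \<I> \<Longrightarrow> openin X B \<Longrightarrow> B \<subseteq> A \<Longrightarrow> B \<in> \<I>"
    and "\<And>\<A>. \<A> \<subseteq> \<I> \<Longrightarrow> card_less \<A> \<alpha> \<Longrightarrow> \<Union>\<A> \<in> \<I>"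
  using assms unfolding alpha_ideal_def by blast+

text \<open>Zorn's lemma yields a filter that is maximal among those containing \<open>\<ff>\<close>
  and missing \<open>\<I>\<close>; distributivity of the lattice of open sets then makes it
  prime.\<close>

lemma prime_filter_extension:
  assumes F: "open_filter X \<ff>" and I: "alpha_ideal Card_omega X \<I>" and dis: "\<ff> \<inter> \<I> = {}"
  obtains \<gg> where "alpha_filter Card_omega X \<gg>" "\<ff> \<subseteq> \<gg>" "\<gg> \<inter> \<I> = {}"
proof -
  let ?P = "{\<gg>. open_filter X \<gg> \<and> \<ff> \<subseteq> \<gg> \<and> \<gg> \<inter> \<I> = {}}"
  have "\<exists>\<gg>\<in>?P. \<forall>\<hh>\<in>?P. \<gg> \<subseteq> \<hh> \<longrightarrow> \<hh> = \<gg>"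
  proof (rule subset_Zorn_nonempty)
    show "?P \<noteq> {}" using F dis by blast
    fix \<C> assume C: "\<C> \<noteq> {}" "subset.chain ?P \<C>"
    then have sub: "\<C> \<subseteq> ?P" by (simp add: subset_chain_def)
    have "open_filter X (\<Union>\<C>)"
      by (rule open_filter_Union_chain) (use C in \<open>auto simp: subset_chain_def\<close>)
    then show "\<Union>\<C> \<in> ?P" using sub C(1) by blast
  qed
  then obtain \<gg> where gP: "\<gg> \<in> ?P" and gmax: "\<forall>\<hh>\<in>?P. \<gg> \<subseteq> \<hh> \<longrightarrow> \<hh> = \<gg>"
    by (rule bexE)
  from gP have g: "open_filter X \<gg>" "\<ff> \<subseteq> \<gg>" "\<gg> \<inter> \<I> = {}" by simp_all
  have max: "\<hh> = \<gg>" if "open_filter X \<hh>" "\<gg> \<subseteq> \<hh>" "\<hh> \<inter> \<I> = {}" for \<hh>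
  proof -
    have "\<hh> \<in> ?P" using that g(2) by simp
    then show ?thesis using gmax that(2) by simp
  qed
  \<comment> \<open>Adjoining \<open>A\<close> to \<open>\<gg>\<close> gives a strictly larger
    filter, which by maximality must meet \<open>\<I>\<close>.\<close>
  have gI: "\<exists>G\<in>\<gg>. G \<inter> A \<in> \<I>" if A: "openin X A" "A \<notin> \<gg>" for A
  proof -
    let ?H = "{B. openin X B \<and> (\<exists>G\<in>\<gg>. G \<inter> A \<subseteq> B)}"
    have "topspace X \<in> \<gg>" "\<And>B. B \<in> \<gg> \<Longrightarrow> openin X B"
      using open_filterD[OF g(1)] by blast+
    then have "A \<in> ?H" "\<gg> \<subseteq> ?H" using A(1) by blast+
    then have "?H \<inter> \<I> \<noteq> {}" using max[OF open_filter_adjoin[OF g(1) A(1)]] A(2) by blast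
    then obtain B G where B: "B \<in> \<I>" "G \<in> \<gg>" "G \<inter> A \<subseteq> B" by blast
    have "openin X (G \<inter> A)" by (rule openin_Int[OF open_filterD(1)[OF g(1) B(2)] A(1)])
    then show ?thesis using alpha_idealD(1)[OF I B(1) _ B(3)] B(2) by blast
  qed
  have "\<exists>A\<in>\<A>. A \<in> \<gg>" if op: "\<forall>A\<in>\<A>. openin X A" and fin: "finite \<A>" and U: "\<Union>\<A> \<in> \<gg>" for \<A>
  proof (rule ccontr)
    assume "\<not> ?thesis"
    then have "\<forall>A\<in>\<A>. \<exists>G\<in>\<gg>. G \<inter> A \<in> \<I>" using op gI by blast
    then obtain G where G: "\<And>A. A \<in> \<A> \<Longrightarrow> G A \<in> \<gg>" "\<And>A. A \<in> \<A> \<Longrightarrow> G A \<inter> A \<in> \<I>" by metis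
    \<comment> \<open>\<open>K\<close> is one member of \<open>\<gg>\<close> that works for all
      \<open>A \<in> \<A>\<close> at once; finiteness of \<open>\<A>\<close> keeps it in
      \<open>\<gg>\<close>. Then \<open>K \<inter> \<Union>\<A>\<close> lies both in
      \<open>\<gg>\<close> and, by distributivity, in \<open>\<I>\<close>.\<close>
    define K where "K = topspace X \<inter> (\<Inter>A\<in>\<A>. G A)"
    have K: "K \<in> \<gg>" unfolding K_def by (rule open_filter_Inter[OF g(1) fin G(1)])
    have "K \<inter> A \<in> \<I>" if A: "A \<in> \<A>" for A
    proof -
      have "openin X (K \<inter> A)" using open_filterD(1)[OF g(1) K] op A by blast
      moreover have "K \<inter> A \<subseteq> G A \<inter> A" using A by (auto simp: K_def)
      ultimately show ?thesis using alpha_idealD(1)[OF I G(2)[OF A]] by simp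
    qed
    then have "\<Union>((\<inter>) K ` \<A>) \<in> \<I>"
      by (intro alpha_idealD(2)[OF I]) (auto simp: fin)
    moreover have "\<Union>((\<inter>) K ` \<A>) = K \<inter> \<Union>\<A>" by blast
    moreover have "K \<inter> \<Union>\<A> \<in> \<gg>" by (rule open_filterD(4)[OF g(1) K U])
    ultimately show False using g(3) by auto
  qed
  then have "alpha_filter Card_omega X \<gg>" using g(1) by (simp add: alpha_filter_def)
  then show thesis using that g by blast
qed

text \<open>For \<open>Card_0\<close> and \<open>Card_1\<close> the filter \<open>\<ff>\<close>
  itself works: in the second case \<open>{} \<in> \<I>\<close>, so missing \<open>\<I>\<close>
  makes it proper. For \<open>Card_Omega\<close> the claim would fail: on a discrete infinite space
  no completely prime filter contains all cofinite sets.\<close>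

lemma alpha_filter_extension:
  assumes "\<alpha> \<noteq> Card_Omega"
    and F: "open_filter X \<ff>" and I: "alpha_ideal \<alpha> X \<I>" and dis: "\<ff> \<inter> \<I> = {}"
  obtains \<gg> where "alpha_filter \<alpha> X \<gg>" "\<ff> \<subseteq> \<gg>" "\<gg> \<inter> \<I> = {}"
proof (cases \<alpha>)
  case Card_0
  then have "alpha_filter \<alpha> X \<ff>" using F by (simp add: alpha_filter_def)
  then show thesis using that dis by blast
next
  case Card_1
  then have "{} \<in> \<I>" using alpha_idealD(2)[OF I, of "{}"] by simp
  then have "alpha_filter \<alpha> X \<ff>" using F dis Card_1 by (auto simp: alpha_filter_def)
  then show thesis using that dis by blast
next
  case Card_omega
  then show thesis using prime_filter_extension[OF F _ dis] I that by metis
next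
  case Card_Omega
  then show thesis using assms(1) by simp
qed

section \<open>Consequences of an algebra structure: core-compactness, stability, sobriety\<close>

context
  fixes \<alpha> :: filter_card and X :: "'a topology" and l :: "'a set set \<Rightarrow> 'a"
  assumes l: "T_structure \<alpha> X l"
begin

lemma T_structure_continuous: "continuous_map (T_space \<alpha> X) X l"
  using l by (simp add: T_structure_def)

lemma T_structure_in_topspace: "alpha_filter \<alpha> X \<ff> \<Longrightarrow> l \<ff> \<in> topspace X"
  using T_structure_smallest_limit(1)[OF l] by (auto simp: converges_to_def)

lemma T_structure_open_nhds: "x \<in> topspace X \<Longrightarrow> l (open_nhds X x) = x"
  using l by (simp add: T_structure_def T_unit_def)

lemma T_structure_limit:
  "alpha_filter \<alpha> X \<ff> \<Longrightarrow> openin X U \<Longrightarrow> l \<ff> \<in> U \<Longrightarrow> U \<in> \<ff>"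
  using T_structure_smallest_limit(1)[OF l, of \<ff>] by (auto simp: converges_to_def open_nhds_def)

lemma T_structure_T0:
  "x \<in> topspace X \<Longrightarrow> y \<in> topspace X \<Longrightarrow> open_nhds X x = open_nhds X y \<Longrightarrow> x = y"
  using T_structure_open_nhds by metis

text \<open>Continuity of \<open>l\<close> at the point \<open>\<ff>\<close>, read off on the basis
  of TX.\<close>

lemma T_structure_preimage:
  assumes "alpha_filter \<alpha> X \<ff>" "openin X U" "l \<ff> \<in> U"
  obtains V where "openin X V" "V \<in> \<ff>" "\<And>\<gg>. alpha_filter \<alpha> X \<gg> \<Longrightarrow> V \<in> \<gg> \<Longrightarrow> l \<gg> \<in> U"
proof -
  have "\<ff> \<in> {\<hh> \<in> topspace (T_space \<alpha> X). l \<hh> \<in> U}"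
    using assms by (simp add: topspace_T_space)
  from openin_T_space_basis[OF openin_continuous_map_preimage[OF T_structure_continuous assms(2)] this]
  obtain V where "openin X V" "V \<in> \<ff>" "sharp \<alpha> X V \<subseteq> {\<hh> \<in> topspace (T_space \<alpha> X). l \<hh> \<in> U}"
    by blast
  then show thesis using that by (auto simp: sharp_def)
qed

text \<open>An open set is down-closed for \<open>pt_le\<close>, so it contains some limit point of
  \<open>\<ff>\<close> exactly if it contains the smallest one, \<open>l \<ff>\<close>.\<close>

lemma way_below_iff:
  "way_below \<alpha> X V U \<longleftrightarrow>
     openin X V \<and> openin X U \<and> (\<forall>\<ff>. alpha_filter \<alpha> X \<ff> \<and> V \<in> \<ff> \<longrightarrow> l \<ff> \<in> U)"
proof -
  have "(\<exists>x\<in>U. converges_to X \<ff> x) \<longleftrightarrow> l \<ff> \<in> U"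
    if U: "openin X U" and f: "alpha_filter \<alpha> X \<ff>" for \<ff>
  proof
    assume "\<exists>x\<in>U. converges_to X \<ff> x"
    then obtain x where "x \<in> U" "pt_le X (l \<ff>) x"
      using T_structure_smallest_limit(2)[OF l f] by blast
    then show "l \<ff> \<in> U" using U by (auto simp: pt_le_def open_nhds_def)
  qed (use T_structure_smallest_limit(1)[OF l f] in blast)
  then show ?thesis unfolding way_below_def topspace_T_space by blast
qed

text \<open>Continuity of \<open>l\<close> at the neighbourhood filter of \<open>x\<close>, which
  \<open>l\<close> sends to \<open>x\<close>, yields the required \<open>V\<close>.\<close>

lemma T_structure_core_compact: "T_core_compact \<alpha> X"
  unfolding T_core_compact_def
proof (intro ballI)
  fix x U assume x: "x \<in> topspace X" and U: "U \<in> open_nhds X x"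
  have "openin X U" "l (open_nhds X x) \<in> U"
    using U T_structure_open_nhds[OF x] by (auto simp: open_nhds_def)
  from T_structure_preimage[OF alpha_filter_open_nhds[OF x] this]
  obtain V where "V \<in> open_nhds X x" "\<And>\<gg>. alpha_filter \<alpha> X \<gg> \<Longrightarrow> V \<in> \<gg> \<Longrightarrow> l \<gg> \<in> U"
    by blast
  then show "\<exists>V\<in>open_nhds X x. way_below \<alpha> X V U"
    using U unfolding way_below_iff by (auto simp: open_nhds_def)
qed

text \<open>A filter containing the intersection of the \<open>V i\<close> contains each
  \<open>V i\<close>, so \<open>l \<ff>\<close> lies in every \<open>U i\<close>.\<close>

lemma T_structure_stable: "T_stable \<alpha> X"
  unfolding T_stable_def
proof (intro allI impI)
  fix n :: nat and V U :: "nat \<Rightarrow> 'a set"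
  assume *: "\<forall>i\<in>{1..n}. way_below \<alpha> X (V i) (U i)"
  have op: "openin X (topspace X \<inter> (\<Inter>i\<in>{1..n}. W i))"
    if "\<And>i. i \<in> {1..n} \<Longrightarrow> openin X (W i)" for W
  \<comment> \<open>\<open>openin_Inter\<close> asks for a nonempty family; for \<open>n = 0\<close>
    the set is \<open>topspace X\<close>.\<close>
  proof (cases "n = 0")
    case False
    then show ?thesis using that by (intro openin_Int openin_topspace openin_Inter) auto
  qed simp
  have "l \<ff> \<in> topspace X \<inter> (\<Inter>i\<in>{1..n}. U i)"
    if f: "alpha_filter \<alpha> X \<ff>" "topspace X \<inter> (\<Inter>i\<in>{1..n}. V i) \<in> \<ff>" for \<ff>
  proof -
    have "V i \<in> \<ff>" if "i \<in> {1..n}" for i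
      using alpha_filterD(1)[OF f, of "V i"] * that unfolding way_below_def by blast
    then show ?thesis
      using * T_structure_in_topspace[OF f(1)] f(1) unfolding way_below_iff by blast
  qed
  then show "way_below \<alpha> X (topspace X \<inter> (\<Inter>i\<in>{1..n}. V i)) (topspace X \<inter> (\<Inter>i\<in>{1..n}. U i))"
    using * op unfolding way_below_iff by simp
qed

text \<open>The open sets meeting an irreducible closed set \<open>C\<close> form a completely prime
  filter that converges to every point of \<open>C\<close>. Its smallest limit point is the generic
  point of \<open>C\<close>.\<close>

lemma T_structure_sober: "sober_space X"
  unfolding sober_space_def
proof (intro allI impI)
  fix C assume C: "irreducible_closedin X C"
  then have cl: "closedin X C" "C \<noteq> {}" and CX: "C \<subseteq> topspace X"
    by (auto simp: irreducible_closedin_def closedin_subset)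
  define \<ff> where "\<ff> = {A. openin X A \<and> A \<inter> C \<noteq> {}}"
  \<comment> \<open>If \<open>A \<inter> B\<close> missed \<open>C\<close>, then
    \<open>C - A\<close> and \<open>C - B\<close> would cover \<open>C\<close>, against
    irreducibility.\<close>
  have meet: "A \<inter> B \<inter> C \<noteq> {}" if A: "openin X A" "A \<inter> C \<noteq> {}" and B: "openin X B" "B \<inter> C \<noteq> {}" for A B
  proof
    assume "A \<inter> B \<inter> C = {}"
    then have "C = (C - A) \<union> (C - B)" by blast
    moreover have "closedin X (C - A)" "closedin X (C - B)" using cl A B by (auto intro: closedin_diff)
    ultimately have "C = C - A \<or> C = C - B" using C unfolding irreducible_closedin_def by blast
    then show False using A B by blast
  qed
  have "open_filter X \<ff>"
    using cl CX meet unfolding open_filter_def \<ff>_def by (auto simp: Int_absorb1)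
  \<comment> \<open>A union meets \<open>C\<close> only if one of its members does, whatever the
    size of the family.\<close>
  then have f: "alpha_filter \<alpha> X \<ff>"
    unfolding alpha_filter_def by (auto simp: \<ff>_def)
  define x where "x = l \<ff>"
  have x: "x \<in> topspace X" using T_structure_in_topspace[OF f] by (simp add: x_def)
  have "x \<in> C"
  proof (rule ccontr)
    assume "x \<notin> C"
    moreover have "openin X (topspace X - C)" using cl by blast
    ultimately have "topspace X - C \<in> \<ff>" using T_structure_limit[OF f] x by (simp add: x_def)
    then show False by (auto simp: \<ff>_def)
  qed
  then have "X closure_of {x} \<subseteq> C" using cl by (simp add: closure_of_minimal)
  moreover have "c \<in> X closure_of {x}" if c: "c \<in> C" for c
  proof -
    have "converges_to X \<ff> c" using c CX by (auto simp: converges_to_def open_nhds_def \<ff>_def)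
    then have "pt_le X x c" using T_structure_smallest_limit(2)[OF l f] by (simp add: x_def)
    then show ?thesis using c CX by (auto simp: in_closure_of pt_le_def open_nhds_def)
  qed
  ultimately have eq: "C = X closure_of {x}" by blast
  show "\<exists>!x. x \<in> topspace X \<and> C = X closure_of {x}"
  proof (intro ex1I[of _ x] conjI x eq)
    fix y assume y: "y \<in> topspace X \<and> C = X closure_of {y}"
    then have "X closure_of {x} = X closure_of {y}" using eq by simp
    moreover have "x \<in> X closure_of {x}" "y \<in> X closure_of {y}" using x y by (simp_all add: in_closure_of)
    ultimately have "x \<in> X closure_of {y}" "y \<in> X closure_of {x}" by auto
    then have "open_nhds X x = open_nhds X y" by (auto simp: in_closure_of open_nhds_def)
    then show "y = x" using T_structure_T0 x y by metis
  qed
qed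

section \<open>The sets \<mu>(A) and the left adjoint of the structure map\<close>

lemma mu_set_iff: "x \<in> mu_set \<alpha> X l A \<longleftrightarrow> (\<exists>\<ff>. alpha_filter \<alpha> X \<ff> \<and> A \<in> \<ff> \<and> x = l \<ff>)"
  using T_structure_in_topspace by (auto simp: mu_set_def topspace_T_space)

text \<open>The adjunction makes \<open>t x\<close> the largest \<alpha>-filter in the fibre of
  \<open>l\<close> over \<open>x\<close>. So \<open>x \<in> mu_set \<alpha> X l A\<close> exactly if
  \<open>A \<in> t x\<close>, and the set is the preimage of \<open>sharp \<alpha> X A\<close> under
  the continuous map \<open>t\<close>.\<close>

lemma left_adjoint_imp_mu_set_open:
  assumes adj: "top_adjunction X (T_space \<alpha> X) t l" and A: "openin X A"
  shows "openin X (mu_set \<alpha> X l A)"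
proof -
  have cont: "continuous_map X (T_space \<alpha> X) t"
    and le: "\<And>x. x \<in> topspace X \<Longrightarrow> pt_le X x (l (t x))"
    and ge: "\<And>\<ff>. alpha_filter \<alpha> X \<ff> \<Longrightarrow> pt_le (T_space \<alpha> X) (t (l \<ff>)) \<ff>"
    using adj by (auto simp: top_adjunction_def topspace_T_space)
  have t: "alpha_filter \<alpha> X (t x)" if "x \<in> topspace X" for x
    using continuous_map_image_subset_topspace[OF cont] that by (auto simp: topspace_T_space)
  have sub: "\<ff> \<subseteq> t (l \<ff>)" if "alpha_filter \<alpha> X \<ff>" for \<ff>
    using ge[OF that] pt_le_T_space[OF t[OF T_structure_in_topspace[OF that]] that] by simp
  \<comment> \<open>Since \<open>t x\<close> contains the neighbourhoods of \<open>x\<close>, it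
    converges to \<open>x\<close>, whence \<open>l (t x)\<close> is below \<open>x\<close>. The
    reverse inequality is the unit of the adjunction, and X is T0.\<close>
  have lt: "l (t x) = x" if x: "x \<in> topspace X" for x
  proof -
    have "open_nhds X x \<subseteq> t x"
      using sub[OF alpha_filter_open_nhds[OF x]] T_structure_open_nhds[OF x] by simp
    then have "pt_le X (l (t x)) x"
      using T_structure_smallest_limit(2)[OF l t[OF x]] x by (simp add: converges_to_def)
    then show ?thesis
      using le[OF x] T_structure_T0[OF T_structure_in_topspace[OF t[OF x]] x] by (simp add: pt_le_def)
  qed
  have "mu_set \<alpha> X l A = {x \<in> topspace X. t x \<in> sharp \<alpha> X A}"
  proof (intro set_eqI iffI)
    fix x assume "x \<in> mu_set \<alpha> X l A"
    then obtain \<ff> where f: "alpha_filter \<alpha> X \<ff>" "A \<in> \<ff>" "x = l \<ff>" by (auto simp: mu_set_iff)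
    then show "x \<in> {x \<in> topspace X. t x \<in> sharp \<alpha> X A}"
      using sub[OF f(1)] t T_structure_in_topspace by (auto simp: sharp_def)
  next
    fix x assume "x \<in> {x \<in> topspace X. t x \<in> sharp \<alpha> X A}"
    then show "x \<in> mu_set \<alpha> X l A" using lt[of x] unfolding mu_set_iff sharp_def by force
  qed
  then show ?thesis using openin_continuous_map_preimage[OF cont openin_sharp[OF A]] by simp
qed

text \<open>The aim is some \<open>\<FF> \<in> TTX\<close> that \<open>T_map\<close> along
  \<open>l\<close> sends to \<open>\<ff>\<close> and that contains
  \<open>sharp \<alpha> X C\<close>. The algebra law then exhibits
  \<open>T_mult \<alpha> X \<FF>\<close> as a filter containing \<open>C\<close> with the same image
  under \<open>l\<close> as \<open>\<ff>\<close>.\<close>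

lemma mu_set_idempotent:
  assumes nO: "\<alpha> \<noteq> Card_Omega" and C: "openin X C" and mu: "openin X (mu_set \<alpha> X l C)"
    and f: "alpha_filter \<alpha> X \<ff>" and mf: "mu_set \<alpha> X l C \<in> \<ff>"
  shows "l \<ff> \<in> mu_set \<alpha> X l C"
proof -
  let ?Y = "T_space \<alpha> X"
  define p where "p U = {\<gg> \<in> topspace ?Y. l \<gg> \<in> U}" for U
  have p_open: "openin ?Y (p U)" if "openin X U" for U
    unfolding p_def by (rule openin_continuous_map_preimage[OF T_structure_continuous that])
  have p_filter: "open_filter ?Y {W. openin ?Y W \<and> (\<exists>U\<in>\<ff>. p U \<subseteq> W)}"
    unfolding open_filter_def
  proof (intro conjI ballI allI impI)
    have "p (topspace X) \<subseteq> topspace ?Y" by (auto simp: p_def)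
    then show "topspace ?Y \<in> {W. openin ?Y W \<and> (\<exists>U\<in>\<ff>. p U \<subseteq> W)}"
      using alpha_filter_topspace[OF f] by blast
  next
    fix V W assume VW: "V \<in> {W. openin ?Y W \<and> (\<exists>U\<in>\<ff>. p U \<subseteq> W)}"
      "W \<in> {W. openin ?Y W \<and> (\<exists>U\<in>\<ff>. p U \<subseteq> W)}"
    then obtain U U' where U: "U \<in> \<ff>" "U' \<in> \<ff>" "p U \<subseteq> V" "p U' \<subseteq> W" by blast
    have "U \<inter> U' \<in> \<ff>" by (rule alpha_filterD(2)[OF f U(1,2)])
    moreover have "p (U \<inter> U') \<subseteq> V \<inter> W" using U(3,4) by (auto simp: p_def)
    ultimately show "V \<inter> W \<in> {W. openin ?Y W \<and> (\<exists>U\<in>\<ff>. p U \<subseteq> W)}" using VW by blast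
  qed blast+
  \<comment> \<open>Containing \<open>\<FF>0\<close> forces
    \<open>sharp \<alpha> X C \<in> \<FF>\<close> and \<open>p U \<in> \<FF>\<close> for every
    \<open>U \<in> \<ff>\<close>.\<close>
  define \<FF>0 where "\<FF>0 = {W. openin ?Y W \<and>
    (\<exists>G\<in>{W. openin ?Y W \<and> (\<exists>U\<in>\<ff>. p U \<subseteq> W)}. G \<inter> sharp \<alpha> X C \<subseteq> W)}"
  have F0: "open_filter ?Y \<FF>0"
    unfolding \<FF>0_def by (rule open_filter_adjoin[OF p_filter openin_sharp[OF C]])
  \<comment> \<open>Missing \<open>\<I>\<close> forces the converse: \<open>p B \<in> \<FF>\<close>
    only if \<open>B \<in> \<ff>\<close>. The \<alpha>-primeness of \<open>\<ff>\<close> turns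
    \<open>\<I>\<close> into an \<alpha>-ideal.\<close>
  define \<I> where "\<I> = {W. openin ?Y W \<and> (\<exists>B. openin X B \<and> B \<notin> \<ff> \<and> W \<subseteq> p B)}"
  have I: "alpha_ideal \<alpha> ?Y \<I>"
    unfolding alpha_ideal_def
  proof (intro conjI ballI allI impI)
    fix \<A> assume A: "\<A> \<subseteq> \<I> \<and> card_less \<A> \<alpha>"
    then have "\<forall>W\<in>\<A>. \<exists>B. openin X B \<and> B \<notin> \<ff> \<and> W \<subseteq> p B" by (auto simp: \<I>_def)
    then obtain B where B: "\<And>W. W \<in> \<A> \<Longrightarrow> openin X (B W) \<and> B W \<notin> \<ff> \<and> W \<subseteq> p (B W)" by metis
    have "card_less (B ` \<A>) \<alpha>" using A card_less_image by metis
    then have "\<Union>(B ` \<A>) \<notin> \<ff>"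
      using alpha_filter_Union[OF f, of "B ` \<A>"] B by blast
    moreover have "openin X (\<Union>(B ` \<A>))" using B by blast
    moreover have "\<Union>\<A> \<subseteq> p (\<Union>(B ` \<A>))" using B by (fastforce simp: p_def)
    moreover have "openin ?Y (\<Union>\<A>)" using A by (auto simp: \<I>_def)
    ultimately show "\<Union>\<A> \<in> \<I>" unfolding \<I>_def by blast
  qed (auto simp: \<I>_def)
  have dis: "\<FF>0 \<inter> \<I> = {}"
  proof (rule ccontr)
    assume "\<not> ?thesis"
    then obtain U B where U: "U \<in> \<ff>" and B: "openin X B" "B \<notin> \<ff>"
      and sub: "p U \<inter> sharp \<alpha> X C \<subseteq> p B" unfolding \<FF>0_def \<I>_def by blast
    \<comment> \<open>A point of the left side is \<open>l \<gg>\<close> with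
      \<open>C \<in> \<gg>\<close>; thus \<open>\<gg>\<close> lies in
      \<open>p U \<inter> sharp \<alpha> X C\<close>, hence in \<open>p B\<close>. As
      \<open>mu_set \<alpha> X l C \<in> \<ff>\<close>, this would put \<open>B\<close> into
      \<open>\<ff>\<close>.\<close>
    have "U \<inter> mu_set \<alpha> X l C \<subseteq> B"
      using sub by (auto simp: mu_set_iff p_def sharp_def topspace_T_space)
    then show False
      using B alpha_filterD(1)[OF f alpha_filterD(2)[OF f U mf]] by blast
  qed
  obtain \<FF> where F: "alpha_filter \<alpha> ?Y \<FF>" "\<FF>0 \<subseteq> \<FF>" "\<FF> \<inter> \<I> = {}"
    using alpha_filter_extension[OF nO F0 I dis] .
  have "p B \<in> \<FF> \<longleftrightarrow> B \<in> \<ff>" if "openin X B" for B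
  proof
    assume "p B \<in> \<FF>"
    then have "p B \<notin> \<I>" using F(3) by blast
    then show "B \<in> \<ff>" using that p_open[OF that] by (auto simp: \<I>_def)
  next
    assume "B \<in> \<ff>"
    then have "p B \<in> \<FF>0" using p_open[OF that] by (auto simp: \<FF>0_def)
    then show "p B \<in> \<FF>" using F(2) by blast
  qed
  then have map: "T_map ?Y X l \<FF> = \<ff>"
    using alpha_filter_openin[OF f] by (auto simp: T_map_def p_def)
  \<comment> \<open>\<open>sharp \<alpha> X\<close> preserves finite intersections and, as its
    elements are \<alpha>-filters, unions of families below \<alpha>. So the filter conditions pass
    from \<open>\<FF>\<close> to its multiplication.\<close>
  have mult: "alpha_filter \<alpha> X (T_mult \<alpha> X \<FF>)"
  proof -
    have sharp_Int: "sharp \<alpha> X (A \<inter> B) = sharp \<alpha> X A \<inter> sharp \<alpha> X B" if "openin X A" "openin X B" for A B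
      using that open_filter_Int_iff by (auto simp: sharp_def alpha_filter_def)
    have sharp_mono: "sharp \<alpha> X A \<subseteq> sharp \<alpha> X B" if "A \<subseteq> B" "openin X B" for A B
      using that by (auto simp: sharp_def intro: alpha_filterD(1))
    have "sharp \<alpha> X (topspace X) = topspace ?Y"
      using alpha_filter_topspace by (auto simp: sharp_def topspace_T_space)
    moreover have "sharp \<alpha> X B \<in> \<FF>" if "sharp \<alpha> X A \<in> \<FF>" "openin X B" "A \<subseteq> B" for A B
      by (rule alpha_filterD(1)[OF F(1) that(1) openin_sharp[OF that(2)] sharp_mono[OF that(3,2)]])
    ultimately have "open_filter X (T_mult \<alpha> X \<FF>)"
      using alpha_filter_topspace[OF F(1)] alpha_filterD(2)[OF F(1)]
      unfolding open_filter_def T_mult_def by (auto simp: sharp_Int)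
    moreover have "\<exists>A\<in>\<A>. A \<in> T_mult \<alpha> X \<FF>"
      if A: "\<forall>A\<in>\<A>. openin X A" "card_less \<A> \<alpha>" "\<Union>\<A> \<in> T_mult \<alpha> X \<FF>" for \<A>
    proof -
      have "sharp \<alpha> X (\<Union>\<A>) \<subseteq> \<Union>(sharp \<alpha> X ` \<A>)"
      proof
        fix \<gg> assume "\<gg> \<in> sharp \<alpha> X (\<Union>\<A>)"
        then have g: "alpha_filter \<alpha> X \<gg>" "\<Union>\<A> \<in> \<gg>" by (simp_all add: sharp_def)
        then show "\<gg> \<in> \<Union>(sharp \<alpha> X ` \<A>)"
          using alpha_filter_Union[OF g(1) _ A(2) g(2)] A(1) by (auto simp: sharp_def)
      qed
      moreover have "openin ?Y (\<Union>(sharp \<alpha> X ` \<A>))" using A(1) openin_sharp by blast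
      ultimately have "\<Union>(sharp \<alpha> X ` \<A>) \<in> \<FF>"
        using A(3) alpha_filterD(1)[OF F(1), of "sharp \<alpha> X (\<Union>\<A>)"] by (simp add: T_mult_def)
      moreover have "openin ?Y W" if "W \<in> sharp \<alpha> X ` \<A>" for W
        using that A(1) openin_sharp by blast
      ultimately have "\<exists>W\<in>sharp \<alpha> X ` \<A>. W \<in> \<FF>"
        by (intro alpha_filter_Union[OF F(1) _ card_less_image[OF A(2)]])
      then show ?thesis using A(1) by (auto simp: T_mult_def)
    qed
    ultimately show ?thesis unfolding alpha_filter_def by blast
  qed
  have "p (topspace X) = topspace ?Y"
    using T_structure_in_topspace by (auto simp: p_def topspace_T_space)
  then have "sharp \<alpha> X C \<in> \<FF>0"
    using openin_sharp[OF C] alpha_filter_topspace[OF f] by (auto simp: \<FF>0_def)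
  then have "C \<in> T_mult \<alpha> X \<FF>" using F(2) C by (auto simp: T_mult_def)
  moreover have "l \<ff> = l (T_mult \<alpha> X \<FF>)"
    using l F(1) map by (auto simp: T_structure_def topspace_T_space)
  ultimately show ?thesis using mult by (auto simp: mu_set_iff)
qed

text \<open>If \<open>A \<in> \<ff>\<close> omits \<open>l \<ff>\<close>, then no point of
  \<open>A\<close> is a limit point, as the smallest one would lie in \<open>A\<close> too. So open
  sets outside \<open>\<ff>\<close> cover \<open>A\<close>, against complete primeness.\<close>

lemma completely_prime_filter_eq_open_nhds:
  assumes O: "\<alpha> = Card_Omega" and f: "alpha_filter \<alpha> X \<ff>"
  shows "\<ff> = open_nhds X (l \<ff>)"
proof
  show "open_nhds X (l \<ff>) \<subseteq> \<ff>"
    using T_structure_limit[OF f] by (auto simp: open_nhds_def)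
  show "\<ff> \<subseteq> open_nhds X (l \<ff>)"
  proof (rule subsetI, rule ccontr)
    fix A assume A: "A \<in> \<ff>" "A \<notin> open_nhds X (l \<ff>)"
    then have opA: "openin X A" and nA: "l \<ff> \<notin> A"
      using alpha_filter_openin[OF f] by (auto simp: open_nhds_def)
    let ?\<U> = "{U. openin X U \<and> U \<notin> \<ff>}"
    have "a \<in> \<Union>?\<U>" if a: "a \<in> A" for a
    proof -
      have "a \<in> topspace X" using a openin_subset[OF opA] by blast
      moreover have "\<not> converges_to X \<ff> a"
        using T_structure_smallest_limit(2)[OF l f, of a] a opA nA
        by (auto simp: pt_le_def open_nhds_def)
      ultimately show ?thesis by (auto simp: converges_to_def open_nhds_def)
    qed
    then have "\<Union>?\<U> \<in> \<ff>"
      by (intro alpha_filterD(1)[OF f A(1)]) auto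
    then show False using alpha_filter_Union[OF f, of ?\<U>] O by auto
  qed
qed

text \<open>This is what makes the fibrewise union of filters closed under intersection, although
  the witnesses for \<open>A\<close> and \<open>B\<close> may be different filters. For
  \<open>Card_Omega\<close> they coincide, since \<open>l\<close> is injective on
  \<alpha>-filters.\<close>

lemma mu_set_Int:
  assumes dc: "\<And>A. openin X A \<Longrightarrow> openin X (mu_set \<alpha> X l A)"
    and A: "openin X A" and B: "openin X B"
    and xA: "x \<in> mu_set \<alpha> X l A" and xB: "x \<in> mu_set \<alpha> X l B"
  shows "x \<in> mu_set \<alpha> X l (A \<inter> B)"
proof -
  obtain \<ff> where f: "alpha_filter \<alpha> X \<ff>" "A \<in> \<ff>" "x = l \<ff>" using xA by (auto simp: mu_set_iff)
  show ?thesis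
  proof (cases "\<alpha> = Card_Omega")
    case True
    obtain \<gg> where g: "alpha_filter \<alpha> X \<gg>" "B \<in> \<gg>" "x = l \<gg>" using xB by (auto simp: mu_set_iff)
    have "\<ff> = \<gg>" using completely_prime_filter_eq_open_nhds[OF True] f g by metis
    then have "A \<inter> B \<in> \<ff>" using alpha_filterD(2)[OF f(1,2)] g(2) by simp
    then show ?thesis using f unfolding mu_set_iff by blast
  next
    case False
    \<comment> \<open>Here \<open>A\<close> is a neighbourhood of the limit \<open>y\<close>, so
      every filter that \<open>l\<close> sends to \<open>y\<close> already contains
      \<open>A\<close>.\<close>
    have "y \<in> mu_set \<alpha> X l (A \<inter> B)" if y: "y \<in> A" "y \<in> mu_set \<alpha> X l B" for y
    proof -
      obtain \<gg> where g: "alpha_filter \<alpha> X \<gg>" "B \<in> \<gg>" "y = l \<gg>" using y by (auto simp: mu_set_iff)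
      then have "A \<in> \<gg>" using T_structure_limit[OF g(1) A] y by simp
      then have "A \<inter> B \<in> \<gg>" using alpha_filterD(2)[OF g(1)] g(2) by simp
      then show ?thesis using g unfolding mu_set_iff by blast
    qed
    then have sub: "A \<inter> mu_set \<alpha> X l B \<subseteq> mu_set \<alpha> X l (A \<inter> B)" by blast
    have AB: "openin X (A \<inter> B)" using A B by blast
    have "mu_set \<alpha> X l B \<in> \<ff>" using T_structure_limit[OF f(1) dc[OF B]] xB f by simp
    then have "mu_set \<alpha> X l (A \<inter> B) \<in> \<ff>"
      using alpha_filterD(1)[OF f(1) alpha_filterD(2)[OF f(1,2)] dc[OF AB] sub] by simp
    then show ?thesis using mu_set_idempotent[OF False AB dc[OF AB] f(1)] f(3) by simp
  qed
qed

text \<open>The value at \<open>x\<close> is the union of all \<alpha>-filters that \<open>l\<close>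
  sends to \<open>x\<close>. Up-closure and primeness pass to such a union; binary intersections
  need \<open>mu_set_Int\<close>.\<close>

lemma mu_set_open_imp_left_adjoint:
  assumes dc: "\<And>A. openin X A \<Longrightarrow> openin X (mu_set \<alpha> X l A)"
  shows "top_adjunction X (T_space \<alpha> X) (\<lambda>x. {A. openin X A \<and> x \<in> mu_set \<alpha> X l A}) l"
proof -
  define t where "t x = {A. openin X A \<and> x \<in> mu_set \<alpha> X l A}" for x
  have t: "alpha_filter \<alpha> X (t x)" if x: "x \<in> topspace X" for x
  proof -
    have "topspace X \<in> t x"
      using x alpha_filter_open_nhds[OF x, of \<alpha>] T_structure_open_nhds[OF x]
      unfolding t_def mu_set_iff by (auto simp: open_nhds_def intro!: exI[of _ "open_nhds X x"])
    moreover have "B \<in> t x" if A: "A \<in> t x" and B: "openin X B" "A \<subseteq> B" for A B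
    proof -
      obtain \<ff> where "alpha_filter \<alpha> X \<ff>" "A \<in> \<ff>" "x = l \<ff>"
        using A unfolding t_def mu_set_iff by blast
      then have "alpha_filter \<alpha> X \<ff> \<and> B \<in> \<ff> \<and> x = l \<ff>"
        using alpha_filterD(1) B by metis
      then show ?thesis using B(1) unfolding t_def mu_set_iff by blast
    qed
    moreover have "A \<inter> B \<in> t x" if "A \<in> t x" "B \<in> t x" for A B
      using that mu_set_Int[OF dc] by (auto simp: t_def)
    ultimately have "open_filter X (t x)"
      unfolding open_filter_def by (auto simp: t_def)
    moreover have "\<exists>A\<in>\<A>. A \<in> t x"
      if A: "\<forall>A\<in>\<A>. openin X A" "card_less \<A> \<alpha>" "\<Union>\<A> \<in> t x" for \<A>
    proof -
      obtain \<ff> where f: "alpha_filter \<alpha> X \<ff>" "\<Union>\<A> \<in> \<ff>" "x = l \<ff>"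
        using A(3) unfolding t_def mu_set_iff by blast
      then obtain B where "B \<in> \<A>" "B \<in> \<ff>" using alpha_filter_Union[OF f(1)] A by blast
      then show ?thesis using f A(1) by (auto simp: t_def mu_set_iff)
    qed
    ultimately show ?thesis unfolding alpha_filter_def by blast
  qed
  have cont: "continuous_map X (T_space \<alpha> X) t"
  proof (rule continuous_map_into_T_space[OF t])
    fix A assume A: "openin X A"
    then have "{x \<in> topspace X. A \<in> t x} = mu_set \<alpha> X l A" by (auto simp: t_def mu_set_def)
    then show "openin X {x \<in> topspace X. A \<in> t x}" using dc[OF A] by simp
  qed
  have "pt_le X x (l (t x))" if x: "x \<in> topspace X" for x
  proof -
    \<comment> \<open>Some filter containing \<open>V\<close> is sent to \<open>x\<close> because
      \<open>V \<in> t x\<close>, and \<open>l\<close> maps every \<alpha>-filter containing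
      \<open>V\<close> into \<open>U\<close>.\<close>
    have "x \<in> U" if U: "openin X U" "l (t x) \<in> U" for U
    proof -
      obtain V where V: "V \<in> t x" "\<And>\<gg>. alpha_filter \<alpha> X \<gg> \<Longrightarrow> V \<in> \<gg> \<Longrightarrow> l \<gg> \<in> U"
        using T_structure_preimage[OF t[OF x] U] by blast
      then show ?thesis by (auto simp: t_def mu_set_iff)
    qed
    then show ?thesis by (auto simp: pt_le_def open_nhds_def)
  qed
  \<comment> \<open>In terms of inclusion this is \<open>\<ff> \<subseteq> t (l \<ff>)\<close>, with
    \<open>\<ff>\<close> itself as the witness for each of its members.\<close>
  moreover have "pt_le (T_space \<alpha> X) (t (l \<ff>)) \<ff>" if f: "alpha_filter \<alpha> X \<ff>" for \<ff>
    unfolding pt_le_T_space[OF t[OF T_structure_in_topspace[OF f]] f]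
    using f alpha_filter_openin[OF f] by (auto simp: t_def mu_set_iff)
  ultimately show ?thesis
    using cont T_structure_continuous
    unfolding top_adjunction_def topspace_T_space t_def[symmetric] by auto
qed

end

theorem theorem3p7:
  fixes \<alpha> :: filter_card and X :: "'a topology"
  shows "T_distributive \<alpha> X \<longleftrightarrow>
    sober_space X \<and> T_core_compact \<alpha> X \<and> T_stable \<alpha> X \<and> T_disconnected \<alpha> X"
proof
  assume "T_distributive \<alpha> X"
  then obtain l t where l: "T_structure \<alpha> X l" and t: "top_adjunction X (T_space \<alpha> X) t l"
    unfolding T_distributive_def by blast
  have "T_disconnected \<alpha> X"
    unfolding T_disconnected_def using l left_adjoint_imp_mu_set_open[OF l t] by blast
  then show "sober_space X \<and> T_core_compact \<alpha> X \<and> T_stable \<alpha> X \<and> T_disconnected \<alpha> X"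
    using T_structure_sober[OF l] T_structure_core_compact[OF l] T_structure_stable[OF l] by blast
next
  assume "sober_space X \<and> T_core_compact \<alpha> X \<and> T_stable \<alpha> X \<and> T_disconnected \<alpha> X"
  then obtain l where l: "T_structure \<alpha> X l"
    and mu: "\<And>A. openin X A \<Longrightarrow> openin X (mu_set \<alpha> X l A)"
    unfolding T_disconnected_def by blast
  show "T_distributive \<alpha> X"
    unfolding T_distributive_def using l mu_set_open_imp_left_adjoint[OF l mu] by blast
qed

end
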